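(* Let $\lambda>1$, $\epsilon\in(0,1)$ and $\delta\in(0,1)$ be fixed. Then the resonant set $\mathcal{R}\subseteq[0,2\pi)$ associated with $\lambda,\epsilon,\delta$ (defined in the context) satisfies $$|\mathcal{R}|<C\,\lambda^{-\frac{1-\delta}{\epsilon}},$$ where $C$ is some constant that can be explicitly computed and $|\mathcal{R}|$ denotes the Lebesgue measure of $\mathcal{R}$.
   Context: Given real numbers $\lambda>1$, $0<\epsilon<1$, $0<\delta<1$, let $$h=\begin{pmatrix}\lambda&0\\0&0\end{pmatrix},\qquad R_\theta=\begin{pmatrix}\cos\theta&-\sin\theta\\ \sin\theta&\cos\theta\end{pmatrix},\quad \theta\in[0,2\pi).$$ For $n\in\mathbb{N}=\{1,2,\dots\}$, a word $W_n$ assigns to $\theta$ a matrix $W_n(\theta)=h^{i_1}R_\theta^{j_1}\cdots h^{i_k}R_\theta^{j_k}$, where $k$ is arbitrary and $i_1,\dots,i_k,j_1,\dots,j_k$ are nonnegative integers with $i_1+\dots+i_k=n$ and $j_1+\dots+j_k=m\le[\epsilon n]$ ($[\cdot]$ denotes the integer part). Thus $W_n(\theta)$ is a product, in some order, of exactly $n$ copies of $h$ and $m\le[\epsilon n]$ copies of $R_\theta$; for each $n$ there are finitely many such words. The norm of a $2\times2$ real matrix is the sum of the absolute values of its four entries. Set $f_n(\theta)=\min_{W_n}\|W_n(\theta)\|$, the minimum being over all such words (all admissible $m$ and all orders of the factors). The resonant set is $$\mathcal{R}=\{\theta\in[0,2\pi)\ :\ \text{there exists } n\in\mathbb{N}\text{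 with } f_n(\theta)<\lambda^{\delta n}\}.$$ *)

theory Defs
  imports "HOL-Analysis.Analysis"
begin

definition hmat :: "real \<Rightarrow> real^2^2" where
  "hmat lam = vector [vector [lam, 0], vector [0, 0]]"

definition rotmat :: "real \<Rightarrow> real^2^2" where
  "rotmat \<theta> = vector [vector [cos \<theta>, - sin \<theta>], vector [sin \<theta>, cos \<theta>]]"

text \<open>Power with respect to the matrix product; the library's \<open>A ^ k\<close> on \<open>real^2^2\<close>
  would be the entrywise power.\<close>

primrec matpow :: "real^2^2 \<Rightarrow> nat \<Rightarrow> real^2^2" where
  "matpow A 0 = mat 1"
| "matpow A (Suc k) = A ** matpow A k"

text \<open>The library's \<open>norm\<close> on \<open>real^2^2\<close> is the Frobenius norm, not this one.\<close>

definition entry_norm :: "real^2^2 \<Rightarrow> real" where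
  "entry_norm A = (\<Sum>i\<in>UNIV. \<Sum>j\<in>UNIV. \<bar>A $ i $ j\<bar>)"

text \<open>A word is given by its list of exponent pairs \<open>[(i\<^sub>1, j\<^sub>1), \<dots>, (i\<^sub>k, j\<^sub>k)]\<close>.\<close>

primrec word_mat :: "real \<Rightarrow> real \<Rightarrow> (nat \<times> nat) list \<Rightarrow> real^2^2" where
  "word_mat lam \<theta> [] = mat 1"
| "word_mat lam \<theta> (p # w) =
     matpow (hmat lam) (fst p) ** matpow (rotmat \<theta>) (snd p) ** word_mat lam \<theta> w"

definition words :: "real \<Rightarrow> nat \<Rightarrow> (nat \<times> nat) list set" where
  "words \<epsilon> n = {w. sum_list (map fst w) = n \<and> int (sum_list (map snd w)) \<le> \<lfloor>\<epsilon> * real n\<rfloor>}"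

text \<open>\<open>words \<epsilon> n\<close> is infinite, as zero exponents are allowed, but it yields only finitely many
  products, so \<open>Min\<close> is a genuine minimum; see \<open>finite_word_norms\<close>.\<close>

definition min_norm :: "real \<Rightarrow> real \<Rightarrow> nat \<Rightarrow> real \<Rightarrow> real" where
  "min_norm lam \<epsilon> n \<theta> = Min ((\<lambda>w. entry_norm (word_mat lam \<theta> w)) ` words \<epsilon> n)"

definition resonant_set :: "real \<Rightarrow> real \<Rightarrow> real \<Rightarrow> real set" where
  "resonant_set lam \<epsilon> \<delta> =
     {\<theta> \<in> {0..<2 * pi}. \<exists>n::nat. n \<ge> 1 \<and> min_norm lam \<epsilon> n \<theta> < lam powr (\<delta> * real n)}"

lemma word_mat_letters:
  "\<exists>l. length l = sum_list (map fst w) + sum_list (map snd w) \<and> set l \<subseteq> {hmat lam, rotmat \<theta>} \<and>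
       word_mat lam \<theta> w = foldr (**) l (mat 1)"
proof (induction w)
  case Nil
  show ?case by (intro exI[of _ "[]"]) simp
next
  case (Cons p w)
  then obtain l where l: "length l = sum_list (map fst w) + sum_list (map snd w)"
    "set l \<subseteq> {hmat lam, rotmat \<theta>}" "word_mat lam \<theta> w = foldr (**) l (mat 1)" by blast
  have pow: "((**) A ^^ k) M = matpow A k ** M" for k and A M :: "real^2^2"
    by (induction k) (simp_all add: matrix_mul_assoc)
  show ?case
    by (intro exI[of _ "replicate (fst p) (hmat lam) @ replicate (snd p) (rotmat \<theta>) @ l"])
      (use l in \<open>auto simp: pow matrix_mul_assoc\<close>)
qed

lemma finite_word_norms: "finite ((\<lambda>w. entry_norm (word_mat lam \<theta> w)) ` words \<epsilon> n)"
proof -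
  let ?L = "{l. set l \<subseteq> {hmat lam, rotmat \<theta>} \<and> length l \<le> n + nat \<lfloor>\<epsilon> * real n\<rfloor>}"
  have "word_mat lam \<theta> w \<in> (\<lambda>l. foldr (**) l (mat 1)) ` ?L" if "w \<in> words \<epsilon> n" for w
    using word_mat_letters[of w lam \<theta>] that by (force simp: words_def)
  then have "(\<lambda>w. entry_norm (word_mat lam \<theta> w)) ` words \<epsilon> n
      \<subseteq> entry_norm ` (\<lambda>l. foldr (**) l (mat 1)) ` ?L" by blast
  moreover have "finite ?L" by (rule finite_lists_length_le) simp
  ultimately show ?thesis by (meson finite_imageI finite_subset)
qed

lemma words_nonempty: "\<epsilon> > 0 \<Longrightarrow> words \<epsilon> n \<noteq> {}"
  by (auto simp: words_def intro!: exI[of _ "[(n, 0)]"])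

end

(* A product of n copies of h and rotations by angles a_0 t, ..., a_n t has norm at least
   lam^n times the product of the |cos (a_i t)| over the inner gaps 0 < i < n, because h is lam
   times the projection to the first axis. Put mu = lam powr (-(1 - delta) / epsilon). If t is
   resonant, this product is below lam powr (-(1 - delta) n), which is at most mu to the power
   sum a_i since sum a_i <= epsilon n. So some factor satisfies |cos (a t)| < mu^a with a >= 1,
   an event of measure at most 2 pi mu^a. Summing the geometric series gives
   2 pi mu / (1 - mu), and for mu > 1/2 the trivial bound 2 pi suffices. *)

theory Submission imports Defs begin

section \<open>Matrix products and a lower bound for words\<close>

lemma matpow_rotmat: "matpow (rotmat \<theta>) j = rotmat (real j * \<theta>)"
proof (induction j)
  case 0
  show ?case by (simp add: rotmat_def mat_def vec_eq_iff forall_2 vector_2)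
next
  case (Suc j)
  then show ?case
    by (simp add: rotmat_def vec_eq_iff forall_2 matrix_matrix_mult_def sum_2 vector_2
        distrib_right cos_add sin_add)
qed

lemma rotmat_mult: "rotmat a ** rotmat b = rotmat (a + b)"
  by (simp add: rotmat_def vec_eq_iff forall_2 matrix_matrix_mult_def sum_2 vector_2
      cos_add sin_add)

text \<open>The exponent has to be positive: \<open>matpow (hmat lam) 0\<close> is the identity,
  while \<open>hmat 1\<close> is the projection to the first axis.\<close>

lemma matpow_hmat_Suc: "matpow (hmat lam) (Suc i) = hmat (lam ^ Suc i)"
proof (induction i)
  case 0
  show ?case by simp
next
  case (Suc i)
  then show ?case
    by (simp add: hmat_def vec_eq_iff forall_2 matrix_matrix_mult_def sum_2 vector_2)
qed

lemma row_rotmat_hmat_mult: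
  "(rotmat a ** (hmat l ** M)) $ 1 $ c = l * cos a * M $ 1 $ c"
  by (simp add: rotmat_def hmat_def matrix_matrix_mult_def sum_2 vector_2)

text \<open>Only the first row is tracked: multiplying on the left by a rotation times
  \<open>hmat l\<close> rescales it by the scalar \<open>l * cos a\<close>, so lower bounds multiply
  along a word.\<close>

definition row_norm :: "real^2^2 \<Rightarrow> real" where
  "row_norm A = \<bar>A $ 1 $ 1\<bar> + \<bar>A $ 1 $ 2\<bar>"

lemma row_norm_le_entry_norm: "row_norm A \<le> entry_norm A"
  by (simp add: row_norm_def entry_norm_def sum_2)

text \<open>Numbers in [0,1] dominate their squares, and the squares of cosine and sine sum to
  1.\<close>

lemma row_norm_rotmat: "1 \<le> row_norm (rotmat a)"
proof -
  have "\<bar>cos a\<bar>\<^sup>2 \<le> \<bar>cos a\<bar>" "\<bar>sin a\<bar>\<^sup>2 \<le> \<bar>sin a\<bar>"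
    by (auto simp: power2_eq_square intro!: mult_left_le_one_le simp del: abs_mult_self_eq)
  moreover have "\<bar>cos a\<bar>\<^sup>2 + \<bar>sin a\<bar>\<^sup>2 = 1" by simp
  ultimately have "1 \<le> \<bar>cos a\<bar> + \<bar>sin a\<bar>" by linarith
  then show ?thesis by (simp add: row_norm_def rotmat_def vector_2)
qed

(* The extra rotations R^k on the left collect the rotations read since the last h. *)
lemma row_norm_word_ge:
  assumes lam: "lam > 0" and \<mu>: "0 \<le> \<mu>" "\<mu> \<le> 1"
    and cos_ge: "\<And>a. \<mu> ^ a \<le> \<bar>cos (real a * \<theta>)\<bar>"
  shows "lam ^ sum_list (map fst w) * \<mu> ^ (k + sum_list (map snd w))
    \<le> row_norm (rotmat (real k * \<theta>) ** word_mat lam \<theta> w)"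
proof (induction w arbitrary: k)
  case Nil
  \<comment> \<open>The rotations after the last \<open>hmat\<close> cost no cosine: the remaining
    matrix is a rotation, of row norm at least 1, and \<open>\<mu> ^ k\<close> is at most 1.\<close>
  show ?case
    using order.trans[OF power_le_one[OF \<mu>, of k] row_norm_rotmat[of "real k * \<theta>"]] by simp
next
  case (Cons p w)
  let ?n = "sum_list (map fst w)" and ?m = "sum_list (map snd w)"
  let ?M = "rotmat (real (snd p) * \<theta>) ** word_mat lam \<theta> w"
  show ?case
  proof (cases "fst p")
    case 0
    \<comment> \<open>Without an \<open>hmat\<close> in this block the gap stays open, and its
      rotations join the \<open>k\<close> pending ones.\<close>
    have "rotmat (real k * \<theta>) ** word_mat lam \<theta> (p # w)
        = rotmat (real (k + snd p) * \<theta>) ** word_mat lam \<theta> w"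
      using 0 by (simp add: matpow_rotmat matrix_mul_assoc rotmat_mult distrib_right)
    then show ?thesis using Cons.IH[of "k + snd p"] 0 by (simp add: add.assoc)
  next
    case (Suc i)
    \<comment> \<open>The block of \<open>hmat\<close> closes a gap of \<open>k\<close> rotations,
      which contributes one cosine; counting restarts with the \<open>snd p\<close> rotations that
      follow.\<close>
    have "row_norm (rotmat (real k * \<theta>) ** word_mat lam \<theta> (p # w))
        = row_norm (rotmat (real k * \<theta>) ** (hmat (lam ^ Suc i) ** ?M))"
      using Suc by (simp only: word_mat.simps matpow_rotmat matpow_hmat_Suc matrix_mul_assoc)
    also have "\<dots> = lam ^ Suc i * \<bar>cos (real k * \<theta>)\<bar> * row_norm ?M"
      using lam unfolding row_norm_def row_rotmat_hmat_mult
      by (simp add: abs_mult distrib_left)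
    also have "\<dots> \<ge> lam ^ Suc i * \<mu> ^ k * (lam ^ ?n * \<mu> ^ (snd p + ?m))"
      using lam \<mu> Cons.IH[of "snd p"] by (intro mult_mono cos_ge) auto
    finally show ?thesis using Suc by (simp add: power_add mult_ac)
  qed
qed

section \<open>From resonance to a small cosine\<close>

lemma min_norm_less_iff:
  assumes "\<epsilon> > 0"
  shows "min_norm lam \<epsilon> n \<theta> < c \<longleftrightarrow> (\<exists>w\<in>words \<epsilon> n. entry_norm (word_mat lam \<theta> w) < c)"
  unfolding min_norm_def
  by (subst Min_less_iff[OF finite_word_norms]) (simp_all add: words_nonempty[OF assms])

text \<open>By contraposition: if no cosine is small, every admissible word has norm at least
  \<open>lam ^ n * \<mu> ^ m\<close>, which is too large for resonance.\<close>

lemma resonant_imp_cos_less: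
  assumes lam: "lam > 1" and \<epsilon>: "\<epsilon> > 0" and \<delta>: "\<delta> < 1"
    and res: "\<theta> \<in> resonant_set lam \<epsilon> \<delta>"
  shows "\<exists>a. \<bar>cos (real (Suc a) * \<theta>)\<bar> < (lam powr (- ((1 - \<delta>) / \<epsilon>))) ^ Suc a"
proof (rule ccontr)
  define \<mu> where "\<mu> = lam powr (- ((1 - \<delta>) / \<epsilon>))"
  assume "\<not> ?thesis"
  then have ge: "\<mu> ^ Suc a \<le> \<bar>cos (real (Suc a) * \<theta>)\<bar>" for a
    by (simp add: \<mu>_def not_less)
  \<comment> \<open>For \<open>a = 0\<close> both sides equal 1, which is why only positive
    multiples occur in the conclusion.\<close>
  have cos_ge: "\<mu> ^ a \<le> \<bar>cos (real a * \<theta>)\<bar>" for a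
    by (cases a) (use ge in auto)
  have \<mu>: "0 \<le> \<mu>" "\<mu> \<le> 1"
    using lam \<epsilon> \<delta> powr_mono[of "- ((1 - \<delta>) / \<epsilon>)" 0 lam] by (auto simp: \<mu>_def)
  obtain n w where w: "w \<in> words \<epsilon> n"
    and small: "entry_norm (word_mat lam \<theta> w) < lam powr (\<delta> * real n)"
    using res \<epsilon> by (auto simp: resonant_set_def min_norm_less_iff)
  define m where "m = sum_list (map snd w)"
  have n: "sum_list (map fst w) = n" and m: "real m \<le> \<epsilon> * real n"
    using w by (auto simp: words_def m_def le_floor_iff)
  have "rotmat 0 = mat 1"
    by (simp add: rotmat_def mat_def vec_eq_iff forall_2 vector_2)
  then have "lam ^ n * \<mu> ^ m \<le> row_norm (word_mat lam \<theta> w)"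
    using row_norm_word_ge[OF _ \<mu> cos_ge, of lam w 0] lam n m_def by simp
  then have upper: "lam ^ n * \<mu> ^ m < lam powr (\<delta> * real n)"
    using row_norm_le_entry_norm[of "word_mat lam \<theta> w"] small by linarith
  \<comment> \<open>This fixes the exponent in \<open>\<mu>\<close>: with at most
    \<open>\<epsilon> * real n\<close> rotations, the total loss is at most a factor
    \<open>lam powr (- (1 - \<delta>) * real n)\<close>.\<close>
  have "(1 - \<delta>) / \<epsilon> * real m \<le> (1 - \<delta>) / \<epsilon> * (\<epsilon> * real n)"
    using m \<epsilon> \<delta> by (intro mult_left_mono) auto
  also have "\<dots> = (1 - \<delta>) * real n"
    using \<epsilon> by simp
  finally have "\<delta> * real n \<le> real n - (1 - \<delta>) / \<epsilon> * real m"
    by (simp add: left_diff_distrib)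
  then have "lam powr (\<delta> * real n) \<le> lam powr (real n + - ((1 - \<delta>) / \<epsilon>) * real m)"
    using lam by (intro powr_mono) auto
  also have "\<dots> = lam ^ n * \<mu> ^ m"
    using lam by (simp only: \<mu>_def powr_add powr_powr[symmetric]) (simp add: powr_realpow)
  finally show False using upper by simp
qed

section \<open>Measurability\<close>

lemma continuous_on_word_mat_entry: "continuous_on UNIV (\<lambda>\<theta>. word_mat lam \<theta> w $ i $ j)"
proof (induction w arbitrary: i j)
  case Nil
  show ?case by simp
next
  case (Cons p w)
  have "continuous_on UNIV (\<lambda>\<theta>. rotmat (real k * \<theta>) $ 1 $ 1)"
    "continuous_on UNIV (\<lambda>\<theta>. rotmat (real k * \<theta>) $ 1 $ 2)"
    "continuous_on UNIV (\<lambda>\<theta>. rotmat (real k * \<theta>) $ 2 $ 1)"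
    "continuous_on UNIV (\<lambda>\<theta>. rotmat (real k * \<theta>) $ 2 $ 2)" for k
    unfolding rotmat_def vector_2 by (intro continuous_intros)+
  then have rot: "continuous_on UNIV (\<lambda>\<theta>. rotmat (real k * \<theta>) $ i $ j)" for k i j
    using exhaust_2[of i] exhaust_2[of j] by auto
  show ?case
    unfolding word_mat.simps matpow_rotmat matrix_matrix_mult_def vec_lambda_beta
    by (intro continuous_on_sum continuous_on_mult continuous_on_const Cons.IH rot)
qed

text \<open>For a fixed word, smallness of the norm is an open condition on the angle, by continuity
  of the entries. The resonant set is a union of such open sets cut down to a half-open interval,
  hence Borel.\<close>

lemma resonant_set_measurable:
  assumes "\<epsilon> > 0"
  shows "resonant_set lam \<epsilon> \<delta> \<in> sets lebesgue"
proof -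
  let ?U = "\<lambda>n w. {\<theta>. entry_norm (word_mat lam \<theta> w) < lam powr (\<delta> * real n)}"
  have eq: "resonant_set lam \<epsilon> \<delta> = {0..<2 * pi} \<inter> (\<Union>n\<in>{1..}. \<Union>w\<in>words \<epsilon> n. ?U n w)"
    using assms by (auto simp: resonant_set_def min_norm_less_iff)
  have "open (?U n w)" for n w
    unfolding entry_norm_def
    by (intro open_Collect_less continuous_intros continuous_on_word_mat_entry)
  then have "open (\<Union>n\<in>{1..}. \<Union>w\<in>words \<epsilon> n. ?U n w)"
    by (intro open_UN ballI)
  then have "resonant_set lam \<epsilon> \<delta> \<in> sets lborel"
    unfolding eq sets_lborel by (rule sets.Int[OF atLeastLessThan_borel borel_open])
  then show ?thesis by (rule sets_completionI_sets)
qed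

section \<open>Sublevel sets of the cosine\<close>

text \<open>Jordan's inequality: the concave graph of sine lies above its chord from 0 to
  \<open>pi / 2\<close>.\<close>

lemma jordan_sin_ge:
  fixes y :: real
  assumes "0 \<le> y" "y \<le> pi / 2"
  shows "2 / pi * y \<le> sin y"
proof -
  have "concave_on {0..pi / 2} (sin :: real \<Rightarrow> real)"
    by (rule f''_le0_imp_concave[where f' = cos and f'' = "\<lambda>x. - sin x"])
      (auto intro!: derivative_eq_intros sin_ge_zero)
  from concave_onD_Icc'[OF this, of y] assms show ?thesis by simp
qed

text \<open>The subtracted point is the zero of cosine at the midpoint of the interval of length
  \<open>pi\<close> containing \<open>x\<close>. The displacement \<open>y\<close> from it is at
  most \<open>pi / 2\<close> in size and satisfies |cos x| = |sin y|, so Jordan's inequality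
  applies.\<close>

lemma abs_cos_ge_dist:
  fixes x :: real
  shows "2 / pi * \<bar>x - (of_int \<lfloor>x / pi\<rfloor> + 1 / 2) * pi\<bar> \<le> \<bar>cos x\<bar>"
proof -
  define k where "k = \<lfloor>x / pi\<rfloor>"
  define y where "y = x - (of_int k + 1 / 2) * pi"
  have "of_int k \<le> x / pi" "x / pi < of_int k + 1" by (auto simp: k_def)
  then have "\<bar>y\<bar> \<le> pi / 2"
    by (simp add: y_def field_simps abs_le_iff)
  then have *: "2 / pi * \<bar>y\<bar> \<le> sin \<bar>y\<bar>" by (intro jordan_sin_ge) auto
  have "x = (y + pi / 2) + of_int k * pi" by (simp add: y_def algebra_simps)
  then have "cos x = cos (y + pi / 2) * cos (of_int k * pi)"
    by (simp add: cos_add sin_int_times_real[of k] mult.commute)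
  moreover have "\<bar>cos (of_int k * pi)\<bar> = 1"
    using sin_cos_squared_add[of "of_int k * pi"]
    by (simp add: mult.commute power2_eq_1_iff abs_if)
  ultimately have "\<bar>cos x\<bar> = \<bar>sin y\<bar>" by (simp add: abs_mult cos_add)
  also have "\<dots> \<ge> sin \<bar>y\<bar>" by (auto simp: abs_if)
  finally show ?thesis using * by (simp add: y_def k_def)
qed

text \<open>The set lies in \<open>2 * a\<close> intervals around the zeros of the cosine. Their
  radius is proportional to \<open>t / a\<close>, so the total length does not depend on
  \<open>a\<close>.\<close>

lemma emeasure_cos_less:
  assumes a: "a > 0" and t: "t \<ge> 0"
  defines "S \<equiv> {\<theta> \<in> {0..<2 * pi}. \<bar>cos (real a * \<theta>)\<bar> < t}"
  shows "S \<in> sets lborel" "emeasure lborel S \<le> ennreal (2 * pi * t)"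
proof -
  have "{\<theta>. \<bar>cos (real a * \<theta>)\<bar> < t} \<in> sets borel"
    by (intro borel_open open_Collect_less continuous_intros)
  then have "{0..<2 * pi} \<inter> {\<theta>. \<bar>cos (real a * \<theta>)\<bar> < t} \<in> sets lborel" by simp
  then show "S \<in> sets lborel" by (simp add: S_def Int_def)
  \<comment> \<open>The \<open>c k\<close> are the zeros of cos(a \<theta>), and \<open>r\<close> is
    the distance at which the linear lower bound \<open>2 / pi * (real a * r)\<close> reaches
    \<open>t\<close>.\<close>
  define c r where "c = (\<lambda>k. (real k + 1 / 2) * pi / real a)" and "r = pi * t / (2 * real a)"
  let ?I = "\<lambda>k. {c k - r .. c k + r}"
  have "S \<subseteq> (\<Union>k<2 * a. ?I k)"
  proof
    fix \<theta> assume "\<theta> \<in> S"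
    then have \<theta>: "0 \<le> \<theta>" "\<theta> < 2 * pi" "\<bar>cos (real a * \<theta>)\<bar> < t" by (auto simp: S_def)
    define k where "k = nat \<lfloor>real a * \<theta> / pi\<rfloor>"
    \<comment> \<open>These bounds make the floor a natural number below \<open>2 * a\<close>, so
      the nearby zero is one of those listed.\<close>
    have "0 \<le> real a * \<theta> / pi" "real a * \<theta> / pi < real (2 * a)"
      using \<theta> a by (auto simp: field_simps)
    then have k: "real k = of_int \<lfloor>real a * \<theta> / pi\<rfloor>" "k < 2 * a"
      by (auto simp: k_def nat_less_iff floor_less_iff)
    have "2 / pi * \<bar>real a * \<theta> - (real k + 1 / 2) * pi\<bar> < t"
      using abs_cos_ge_dist[of "real a * \<theta>"] \<theta>(3) k(1) by simp
    moreover have "real a * \<theta> - (real k + 1 / 2) * pi = real a * (\<theta> - c k)"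
      using a by (simp add: c_def field_simps)
    ultimately have "2 / pi * (real a * \<bar>\<theta> - c k\<bar>) < t"
      by (simp add: abs_mult)
    then have "\<bar>\<theta> - c k\<bar> < r"
      using a by (simp add: r_def field_simps)
    then show "\<theta> \<in> (\<Union>k<2 * a. ?I k)"
      using k(2) by (intro UN_I[of k]) (auto simp: abs_less_iff)
  qed
  then have "emeasure lborel S \<le> emeasure lborel (\<Union>k<2 * a. ?I k)"
    by (intro emeasure_mono) auto
  also have "\<dots> \<le> (\<Sum>k<2 * a. emeasure lborel (?I k))"
    by (intro emeasure_subadditive_finite) auto
  also have "\<dots> = (\<Sum>k<2 * a. ennreal (2 * r))"
    using t by (intro sum.cong refl) (simp add: r_def)
  also have "\<dots> = ennreal (2 * pi * t)"
    using a t by (simp add: r_def sum_constant ennreal_of_nat_eq_real_of_nat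
        ennreal_mult[symmetric] field_simps del: sum_constant_scale)
  finally show "emeasure lborel S \<le> ennreal (2 * pi * t)" .
qed

section \<open>Summation over the gap lengths\<close>

text \<open>A union bound over the lengths \<open>Suc a\<close>; the geometric series starts at
  exponent 1, which supplies the factor \<open>\<mu>\<close>.\<close>

lemma emeasure_resonant_set_le:
  assumes "lam > 1" "\<epsilon> > 0" "\<delta> < 1"
  defines "\<mu> \<equiv> lam powr (- ((1 - \<delta>) / \<epsilon>))"
  assumes \<mu>: "\<mu> < 1"
  shows "emeasure lebesgue (resonant_set lam \<epsilon> \<delta>) \<le> ennreal (2 * pi * (\<mu> / (1 - \<mu>)))"
proof -
  let ?S = "\<lambda>a. {\<theta> \<in> {0..<2 * pi}. \<bar>cos (real (Suc a) * \<theta>)\<bar> < \<mu> ^ Suc a}"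
  have "\<mu> \<ge> 0" by (simp add: \<mu>_def)
  have S: "?S a \<in> sets lborel" "emeasure lborel (?S a) \<le> ennreal (2 * pi * \<mu> ^ Suc a)" for a
    by (rule emeasure_cos_less; use \<open>\<mu> \<ge> 0\<close> in simp)+
  have sub: "resonant_set lam \<epsilon> \<delta> \<subseteq> (\<Union>a. ?S a)"
    using resonant_imp_cos_less[OF assms(1-3)] by (fastforce simp: resonant_set_def \<mu>_def)
  have "emeasure lebesgue (resonant_set lam \<epsilon> \<delta>) \<le> emeasure lebesgue (\<Union>a. ?S a)"
    using S(1) by (intro emeasure_mono sub sets.countable_UN) auto
  also have "\<dots> = emeasure lborel (\<Union>a. ?S a)"
  proof -
    have "(\<Union>a. ?S a) \<in> sets lborel" using S(1) by (intro sets.countable_UN) auto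
    then show ?thesis by simp
  qed
  also have "\<dots> \<le> (\<Sum>a. emeasure lborel (?S a))"
    using S(1) by (intro emeasure_subadditive_countably) auto
  also have "\<dots> \<le> (\<Sum>a. ennreal (2 * pi * \<mu> ^ Suc a))"
    using S(2) by (intro suminf_le) auto
  also have "\<dots> = ennreal (2 * pi * (\<mu> / (1 - \<mu>)))"
  proof (rule suminf_ennreal_eq)
    show "(\<lambda>a. 2 * pi * \<mu> ^ Suc a) sums (2 * pi * (\<mu> / (1 - \<mu>)))"
      using geometric_sums[of \<mu>] \<mu> \<open>\<mu> \<ge> 0\<close> sums_mult[of _ _ "2 * pi * \<mu>"]
      by (fastforce simp: mult_ac)
  qed (use \<open>\<mu> \<ge> 0\<close> in auto)
  finally show ?thesis .
qed

theorem mainTheorem2: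
  "\<exists>C::real. \<forall>lam \<epsilon> \<delta> :: real.
     lam > 1 \<longrightarrow> 0 < \<epsilon> \<longrightarrow> \<epsilon> < 1 \<longrightarrow> 0 < \<delta> \<longrightarrow> \<delta> < 1 \<longrightarrow>
       resonant_set lam \<epsilon> \<delta> \<in> sets lebesgue \<and>
       measure lebesgue (resonant_set lam \<epsilon> \<delta>) < C * lam powr (- ((1 - \<delta>) / \<epsilon>))"
proof (intro exI[of _ "5 * pi"] allI impI conjI)
  fix lam \<epsilon> \<delta> :: real
  assume asm: "lam > 1" "0 < \<epsilon>" "\<delta> < 1"
  then show "resonant_set lam \<epsilon> \<delta> \<in> sets lebesgue" by (simp add: resonant_set_measurable)
  define \<mu> where "\<mu> = lam powr (- ((1 - \<delta>) / \<epsilon>))"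
  have "\<mu> > 0" using asm by (simp add: \<mu>_def)
  have "emeasure lebesgue (resonant_set lam \<epsilon> \<delta>) \<le> ennreal (4 * pi * \<mu>)"
  proof (cases "\<mu> \<le> 1 / 2")
    case True
    have "emeasure lebesgue (resonant_set lam \<epsilon> \<delta>) \<le> ennreal (2 * pi * (\<mu> / (1 - \<mu>)))"
      unfolding \<mu>_def using asm True by (intro emeasure_resonant_set_le) (simp_all add: \<mu>_def)
    also have "\<mu> / (1 - \<mu>) \<le> 2 * \<mu>"
      using True \<open>\<mu> > 0\<close> by (simp add: field_simps)
    then have "ennreal (2 * pi * (\<mu> / (1 - \<mu>))) \<le> ennreal (4 * pi * \<mu>)"
      using mult_left_mono[of "\<mu> / (1 - \<mu>)" "2 * \<mu>" "2 * pi"] by (intro ennreal_leI) simp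
    finally show ?thesis .
  next
    \<comment> \<open>Here \<open>2 * pi\<close>, the length of the whole interval, is already below
      \<open>4 * pi * \<mu>\<close>.\<close>
    case False
    have "emeasure lebesgue (resonant_set lam \<epsilon> \<delta>) \<le> emeasure lebesgue {0..<2 * pi}"
      by (intro emeasure_mono) (auto simp: resonant_set_def)
    also have "\<dots> \<le> ennreal (4 * pi * \<mu>)"
      using False by (simp add: ennreal_leI)
    finally show ?thesis .
  qed
  then have "measure lebesgue (resonant_set lam \<epsilon> \<delta>) \<le> 4 * pi * \<mu>"
    using \<open>\<mu> > 0\<close> by (simp add: measure_def enn2real_leI)
  \<comment> \<open>Both cases give the constant \<open>4 * pi\<close>; enlarging it to
    \<open>5 * pi\<close> makes the inequality strict, since \<open>\<mu>\<close> is
    positive.\<close>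
  also have "\<dots> < 5 * pi * \<mu>" using \<open>\<mu> > 0\<close> by simp
  finally show "measure lebesgue (resonant_set lam \<epsilon> \<delta>) < 5 * pi * lam powr (- ((1 - \<delta>) / \<epsilon>))"
    by (simp add: \<mu>_def)
qed

end
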